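(* Let $m\ge 3$, let $X_1^0,\dots,X_m^0$ be a basic tuple with constants $r,R$, let $\lambda> 1+R/r$, $\varepsilon=1/\lambda$, and let $B^{(\infty)}$ be the infinite generation of random variables (all as defined in the context). Let $f:[0,1]\to\mathbb R$ be piecewise continuous and let $K\in\mathbb R$. If $J_f(X_i^0)=K$ for all $1\le i\le m$, then for every $X\in B^{(\infty)}$, $$J_f(X)=K\,\frac{\varepsilon}{1-\varepsilon}.$$
   Context: Quantile function of a random variable $X$: $x(u)=\inf\{x:\mathbf P(X\le x)\ge u\}$, $u\in(0,1)$. For a random variable $X$ with quantile function $x$, $J_f(X)=\int_0^1 f(u)x(u)\,du$. For random variables, $X\prec Y$ means $\mathbf E\,\mathrm{sign}(Y-X)>0$. Basic tuple: independent random variables $X_1^0,\dots,X_m^0$, $m\ge3$, with quantile functions $x_1^0,\dots,x_m^0$, such that $X_1^0\prec X_2^0\prec\dots\prec X_m^0\prec X_1^0$ and $$\inf_{u_1,u_2\in(0,1)}\min_{i_1\ne i_2}|x^0_{i_1}(u_1)-x^0_{i_2}(u_2)|=r>0,\qquad \sup_{u_1,u_2\in(0,1)}\max_{i_1\ne i_2}|x^0_{i_1}(u_1)-x^0_{i_2}(u_2)|=R<\infty.$$ Infinite generation: for $i_1\dots i_l\dots\in\{1,\dots,m\}^{\mathbb N}$ put $x_{i_1\dots i_l\dots}(u)=\sum_{l=1}^\infty\varepsilon^l x^0_{i_l}(u)$. Let $U_{i_1\dots i_l\dots}$, indexed by $\{1,\dots,m\}^{\mathbb N}$, be jointly independent random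 variables uniformly distributed on $[0,1]$, and $X_{i_1\dots i_l\dots}=x_{i_1\dots i_l\dots}(U_{i_1\dots i_l\dots})$ (whose quantile function is $x_{i_1\dots i_l\dots}$). Then $B^{(\infty)}$ is the set of all $X_{i_1\dots i_l\dots}$. *)

theory Defs
  imports "HOL-Probability.Probability"
begin

text \<open>Only the values for \<open>0 < u < 1\<close> are meaningful; there the infimum is over a nonempty set
  that is bounded below.\<close>

definition quantile :: "'a measure \<Rightarrow> ('a \<Rightarrow> real) \<Rightarrow> real \<Rightarrow> real" where
  "quantile M X u = Inf {x. measure M {\<omega> \<in> space M. X \<omega> \<le> x} \<ge> u}"

definition J :: "'a measure \<Rightarrow> (real \<Rightarrow> real) \<Rightarrow> ('a \<Rightarrow> real) \<Rightarrow> real" where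
  "J M f X = (LINT u:{0<..<1}|lborel. f u * quantile M X u)"

definition rv_prec :: "'a measure \<Rightarrow> ('a \<Rightarrow> real) \<Rightarrow> ('a \<Rightarrow> real) \<Rightarrow> bool" where
  "rv_prec M X Y \<longleftrightarrow> (LINT \<omega>|M. sgn (Y \<omega> - X \<omega>)) > 0"

text \<open>The infimum and supremum are taken in the extended reals, so that the second equation
  includes the finiteness of the supremum.\<close>

definition basic_tuple ::
  "'a measure \<Rightarrow> nat \<Rightarrow> (nat \<Rightarrow> 'a \<Rightarrow> real) \<Rightarrow> real \<Rightarrow> real \<Rightarrow> bool" where
  "basic_tuple M m X r R \<longleftrightarrow>
     m \<ge> 3 \<and> prob_space M \<and> prob_space.indep_vars M (\<lambda>_. borel) X {1..m} \<and>
     (\<forall>i\<in>{1..<m}. rv_prec M (X i) (X (i + 1))) \<and> rv_prec M (X m) (X 1) \<and>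
     (INF u1\<in>{0<..<1}. INF u2\<in>{0<..<1}.
        Min {ereal \<bar>quantile M (X i1) u1 - quantile M (X i2) u2\<bar> | i1 i2.
             i1 \<in> {1..m} \<and> i2 \<in> {1..m} \<and> i1 \<noteq> i2}) = ereal r \<and> r > 0 \<and>
     (SUP u1\<in>{0<..<1}. SUP u2\<in>{0<..<1}.
        Max {ereal \<bar>quantile M (X i1) u1 - quantile M (X i2) u2\<bar> | i1 i2.
             i1 \<in> {1..m} \<and> i2 \<in> {1..m} \<and> i1 \<noteq> i2}) = ereal R"

definition index_words :: "nat \<Rightarrow> (nat \<Rightarrow> nat) set" where
  "index_words m = UNIV \<rightarrow> {1..m}"

text \<open>Words are numbered from 0, so the letter \<open>s l\<close> is the one in position \<open>l + 1\<close> and carries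
  the weight \<open>\<epsilon>\<^sup>l\<^sup>+\<^sup>1\<close>.\<close>

definition word_quantile ::
  "(nat \<Rightarrow> real \<Rightarrow> real) \<Rightarrow> real \<Rightarrow> (nat \<Rightarrow> nat) \<Rightarrow> real \<Rightarrow> real" where
  "word_quantile x \<epsilon> s u = (\<Sum>l. \<epsilon> ^ (l + 1) * x (s l) u)"

definition indep_uniform_family :: "'b measure \<Rightarrow> 'i set \<Rightarrow> ('i \<Rightarrow> 'b \<Rightarrow> real) \<Rightarrow> bool" where
  "indep_uniform_family N I U \<longleftrightarrow>
     prob_space N \<and> prob_space.indep_vars N (\<lambda>_. borel) U I \<and>
     (\<forall>i\<in>I. distr N borel (U i) = uniform_measure lborel {0..1})"

definition infinite_generation ::
  "(nat \<Rightarrow> real \<Rightarrow> real) \<Rightarrow> nat \<Rightarrow> real \<Rightarrow> ((nat \<Rightarrow> nat) \<Rightarrow> 'b \<Rightarrow> real) \<Rightarrow> ('b \<Rightarrow> real) set" where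
  "infinite_generation x m \<epsilon> U = (\<lambda>s \<omega>. word_quantile x \<epsilon> s (U s \<omega>)) ` index_words m"

text \<open>Continuity off a finite set, together with finite one-sided limits everywhere. Since
  \<open>{a..b} - S\<close> is relatively open in \<open>{a..b}\<close>, \<open>continuous_on\<close> means continuity within
  \<open>{a..b}\<close> at every point outside \<open>S\<close>.\<close>

definition piecewise_continuous_on :: "real \<Rightarrow> real \<Rightarrow> (real \<Rightarrow> real) \<Rightarrow> bool" where
  "piecewise_continuous_on a b f \<longleftrightarrow>
     (\<exists>S. finite S \<and> continuous_on ({a..b} - S) f) \<and>
     (\<forall>t\<in>{a<..b}. \<exists>l. (f \<longlongrightarrow> l) (at_left t)) \<and>
     (\<forall>t\<in>{a..<b}. \<exists>l. (f \<longlongrightarrow> l) (at_right t))"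

end

theory Submission
  imports Defs
begin

text \<open>Quantile functions of real random variables are monotone and left-continuous on the unit
  interval. These properties, as well as the common bound that the finite diameter forces on the
  basic tuple, pass to the geometrically weighted series, which is therefore the quantile function
  of its value at a uniform random variable. The value of \<open>J\<close> then follows by integrating the
  series term by term.\<close>

section \<open>Quantile functions\<close>

text \<open>Right-continuity of the distribution function makes the infimum attained, which gives a
  Galois connection with the quantile function. Monotonicity and left-continuity of quantiles are
  both read off from it.\<close>

lemma (in prob_space) quantile_le_iff:
  assumes [measurable]: "X \<in> borel_measurable M" and "0 < u" "u < 1"
  shows "quantile M X u \<le> t \<longleftrightarrow> u \<le> measure M {\<omega> \<in> space M. X \<omega> \<le> t}"
proof -
  interpret D: cdf_distribution "distr M borel X"
    by (simp add: cdf_distribution_def real_distribution_distr)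
  have "cdf (distr M borel X) y = measure M {\<omega> \<in> space M. X \<omega> \<le> y}" for y
    by (auto simp: cdf_def measure_distr vimage_def Int_def intro!: arg_cong[where f = "measure M"])
  then show ?thesis
    using D.pseudoinverse[of u t] assms by (simp add: quantile_def)
qed

lemma (in prob_space) mono_on_quantile:
  assumes "X \<in> borel_measurable M"
  shows "mono_on {0<..<1} (quantile M X)"
proof (rule mono_onI)
  fix u v :: real assume *: "u \<in> {0<..<1}" "v \<in> {0<..<1}" "u \<le> v"
  then have "v \<le> measure M {\<omega> \<in> space M. X \<omega> \<le> quantile M X v}"
    using quantile_le_iff[OF assms, of v "quantile M X v"] by auto
  with * show "quantile M X u \<le> quantile M X v"
    using quantile_le_iff[OF assms, of u "quantile M X v"] by auto
qed

text \<open>The bound from below is the strict form of the Galois connection; the bound from above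
  is monotonicity.\<close>

lemma (in prob_space) quantile_tendsto_at_left:
  assumes X: "X \<in> borel_measurable M" and u: "0 < u" "u < 1"
  shows "(quantile M X \<longlongrightarrow> quantile M X u) (at_left u)"
proof (rule order_tendstoI)
  fix t assume "t < quantile M X u"
  then have "measure M {\<omega> \<in> space M. X \<omega> \<le> t} < u"
    using quantile_le_iff[OF X u, of t] by simp
  then show "eventually (\<lambda>v. t < quantile M X v) (at_left u)"
    unfolding eventually_at_left[OF u(1)]
  \<comment> \<open>Every \<open>v\<close> strictly between the probability of
    \<open>X \<le> t\<close> and \<open>u\<close> has a quantile above \<open>t\<close>. The maximum
    with 0 keeps \<open>v\<close> visibly positive.\<close>
  proof (intro exI[of _ "max 0 (measure M {\<omega> \<in> space M. X \<omega> \<le> t})"] conjI allI impI)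
    fix v assume "max 0 (measure M {\<omega> \<in> space M. X \<omega> \<le> t}) < v" "v < u"
    then have "0 < v" "v < 1" "\<not> v \<le> measure M {\<omega> \<in> space M. X \<omega> \<le> t}"
      using u by linarith+
    then show "t < quantile M X v"
      using quantile_le_iff[OF X, of v t] by simp
  qed (use u in simp)
next
  fix t assume t: "quantile M X u < t"
  show "eventually (\<lambda>v. quantile M X v < t) (at_left u)"
    unfolding eventually_at_left[OF u(1)]
  proof (intro exI[of _ 0] conjI allI impI)
    fix v assume "0 < v" "v < u"
    then have "quantile M X v \<le> quantile M X u"
      using mono_onD[OF mono_on_quantile[OF X], of v u] u by auto
    with t show "quantile M X v < t" by simp
  qed (rule u)
qed

text \<open>Outside the open unit interval the quantile function has junk values, but they are constant
  on each side.\<close>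

lemma (in prob_space) borel_measurable_quantile:
  assumes "X \<in> borel_measurable M"
  shows "quantile M X \<in> borel_measurable borel"
proof (rule borel_measurable_piecewise_mono[of "{{..0}, {0<..<1}, {1}, {1<..}}"])
  have nonpos: "quantile M X u = Inf UNIV" if "u \<le> 0" for u
  proof -
    have "u \<le> measure M A" for A
      using order.trans[OF that measure_nonneg] .
    then show ?thesis by (simp add: quantile_def)
  qed
  have gt1: "quantile M X u = Inf {}" if "u > 1" for u
  proof -
    have "\<not> u \<le> measure M A" for A
      using le_less_trans[OF prob_le_1 that] by (simp add: not_le)
    then show ?thesis by (simp add: quantile_def)
  qed
  \<comment> \<open>The point 1 is a piece of its own: for \<open>X\<close> unbounded above, the
    infimum there may be over the empty set and so have an unspecified value.\<close>
  show "mono_on c (quantile M X)" if "c \<in> {{..0}, {0<..<1}, {1}, {1<..}}" for c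
  proof -
    have "mono_on {..0} (quantile M X)" "mono_on {1} (quantile M X)" "mono_on {1<..} (quantile M X)"
      by (rule mono_onI; simp add: nonpos gt1)+
    with that mono_on_quantile[OF assms] show ?thesis
      by (elim insertE emptyE) simp_all
  qed
  show "\<Union>{{..0}, {0<..<1}, {1}, {1<..}} = (UNIV :: real set)"
    by (auto simp: not_le)
qed auto

text \<open>The probability of \<open>w (U \<omega>) \<le> t\<close> is the length of a sublevel set
  of \<open>w\<close>. By monotonicity this set is, up to endpoints, an initial segment of the unit
  interval; left-continuity puts \<open>u\<close> into it as soon as its length reaches
  \<open>u\<close>.\<close>

lemma (in prob_space) quantile_comp_uniform:
  assumes U [measurable]: "U \<in> borel_measurable M"
    and distr_U: "distr M borel U = uniform_measure lborel {0..1}"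
    and w [measurable]: "w \<in> borel_measurable borel"
    and mono: "mono_on {0<..<1} w"
    and left: "(w \<longlongrightarrow> w u) (at_left u)"
    and u: "0 < u" "u < 1"
  shows "quantile M (\<lambda>\<omega>. w (U \<omega>)) u = w u"
proof -
  have meas: "measure M {\<omega> \<in> space M. w (U \<omega>) \<le> t} = measure lborel ({0..1} \<inter> {v. w v \<le> t})" for t
  proof -
    have "measure M {\<omega> \<in> space M. w (U \<omega>) \<le> t} = measure (distr M borel U) {v. w v \<le> t}"
      by (subst measure_distr) (auto intro!: arg_cong[where f = "measure M"])
    then show ?thesis
      by (simp add: distr_U)
  qed
  \<comment> \<open>\<open>measure\<close> has the default value 0 on sets of infinite measure, so
    comparing measures of nested sets requires finiteness.\<close>
  have fin: "emeasure lborel ({0..1} \<inter> {v. w v \<le> t}) \<noteq> \<infinity>" for t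
    using emeasure_mono[of "{0..1} \<inter> {v. w v \<le> t}" "{0..1}" lborel] by (auto simp: top_unique)
  have "u \<le> measure M {\<omega> \<in> space M. w (U \<omega>) \<le> t} \<longleftrightarrow> w u \<le> t" for t
  proof
    assume "w u \<le> t"
    \<comment> \<open>The point 0 is left out because \<open>w\<close> is monotone only on the open
      interval.\<close>
    then have "{0<..u} \<subseteq> {0..1} \<inter> {v. w v \<le> t}"
      using u mono_onD[OF mono, of _ u] by fastforce
    then have "measure lborel {0<..u} \<le> measure lborel ({0..1} \<inter> {v. w v \<le> t})"
      using fin by (intro measure_mono_fmeasurable) (auto simp: fmeasurable_def less_top)
    then show "u \<le> measure M {\<omega> \<in> space M. w (U \<omega>) \<le> t}"
      using u by (simp add: meas)
  next
    assume le: "u \<le> measure M {\<omega> \<in> space M. w (U \<omega>) \<le> t}"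
    show "w u \<le> t"
    proof (rule ccontr)
      assume "\<not> w u \<le> t"
      then have "eventually (\<lambda>v. t < w v) (at_left u)"
        using left by (intro order_tendstoD(1)) auto
      moreover have "eventually (\<lambda>v. 0 < v) (at_left u)"
        using u by (intro order_tendstoD(1)[OF tendsto_ident_at])
      moreover have "eventually (\<lambda>v. v < u) (at_left u)"
        by (auto simp: eventually_at_filter)
      ultimately have "eventually (\<lambda>v. t < w v \<and> 0 < v \<and> v < u) (at_left u)"
        by eventually_elim auto
      then obtain v where v: "t < w v" "0 < v" "v < u"
        using eventually_happens'[of "at_left u"] by auto
      \<comment> \<open>Right of \<open>v\<close> monotonicity keeps \<open>w\<close> above
        \<open>t\<close>, except possibly at the uncontrolled endpoint 1, a null set. Hence the
        sublevel set has length at most \<open>v\<close>, which is below \<open>u\<close>.\<close>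
      have "x \<le> v \<or> x = 1" if "x \<in> {0..1}" "w x \<le> t" for x
        using that v u mono_onD[OF mono, of v x] by fastforce
      then have "{0..1} \<inter> {x. w x \<le> t} \<subseteq> {0..v} \<union> {1}" by fastforce
      then have "measure lborel ({0..1} \<inter> {x. w x \<le> t}) \<le> measure lborel ({0..v} \<union> {1})"
        using v by (intro measure_mono_fmeasurable fmeasurable.Un) (auto simp: fmeasurable_def)
      also have "\<dots> \<le> measure lborel {0..v} + measure lborel {1::real}"
        by (intro measure_Un_le) auto
      finally show False using le v by (simp add: meas)
    qed
  qed
  then have "quantile M (\<lambda>\<omega>. w (U \<omega>)) u = Inf {w u..}"
    by (simp add: quantile_def atLeast_def)
  then show ?thesis by simp
qed

section \<open>Geometrically weighted series\<close>

lemma norm_geometric_term_le: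
  fixes y \<epsilon> B :: real
  assumes "0 \<le> \<epsilon>" "\<bar>y\<bar> \<le> B"
  shows "norm (\<epsilon> ^ (l + 1) * y) \<le> B * \<epsilon> ^ (l + 1)"
  using mult_left_mono[OF assms(2), of "\<epsilon> ^ (l + 1)"] assms(1)
  by (simp add: abs_mult mult.commute)

lemma summable_geometric_bound:
  fixes B \<epsilon> :: real
  assumes "0 \<le> \<epsilon>" "\<epsilon> < 1"
  shows "summable (\<lambda>l. B * \<epsilon> ^ (l + 1))"
  using assms by (auto intro!: summable_mult summable_geometric)

lemma summable_norm_geometric_series:
  fixes y :: "nat \<Rightarrow> real"
  assumes "0 \<le> \<epsilon>" "\<epsilon> < 1" "\<And>l. \<bar>y l\<bar> \<le> B"
  shows "summable (\<lambda>l. norm (\<epsilon> ^ (l + 1) * y l))"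
proof (rule summable_comparison_test'[OF summable_geometric_bound[OF assms(1,2)]])
  show "norm (norm (\<epsilon> ^ (l + 1) * y l)) \<le> B * \<epsilon> ^ (l + 1)" for l
    using norm_geometric_term_le[OF assms(1,3)] by simp
qed

lemma mono_on_word_quantile:
  assumes "0 \<le> \<epsilon>" "\<epsilon> < 1"
    and bound: "\<And>l u. u \<in> A \<Longrightarrow> \<bar>x (s l) u\<bar> \<le> B"
    and mono: "\<And>l. mono_on A (x (s l))"
  shows "mono_on A (word_quantile x \<epsilon> s)"
proof (rule mono_onI)
  fix u v assume uv: "u \<in> A" "v \<in> A" "u \<le> v"
  have "summable (\<lambda>l. \<epsilon> ^ (l + 1) * x (s l) t)" if "t \<in> A" for t
    by (rule summable_norm_cancel[OF summable_norm_geometric_series[OF assms(1,2) bound[OF that]]])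
  moreover have "\<epsilon> ^ (l + 1) * x (s l) u \<le> \<epsilon> ^ (l + 1) * x (s l) v" for l
    using assms uv by (intro mult_left_mono mono_onD[OF mono]) auto
  ultimately show "word_quantile x \<epsilon> s u \<le> word_quantile x \<epsilon> s v"
    unfolding word_quantile_def using uv by (intro suminf_le)
qed

text \<open>Tannery's theorem, that is, dominated convergence for series, with majorant
  \<open>B * \<epsilon> ^ (l + 1)\<close>. The bound holds eventually for all letters at once, so
  that one majorant serves the whole series.\<close>

lemma word_quantile_tendsto:
  assumes "0 \<le> \<epsilon>" "\<epsilon> < 1" and F: "F \<noteq> bot"
    and bound: "eventually (\<lambda>u. \<forall>l. \<bar>x (s l) u\<bar> \<le> B) F"
    and tendsto: "\<And>l. (x (s l) \<longlongrightarrow> x (s l) u) F"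
  shows "(word_quantile x \<epsilon> s \<longlongrightarrow> word_quantile x \<epsilon> s u) F"
proof -
  have "eventually (\<lambda>(l, v). norm (\<epsilon> ^ (l + 1) * x (s l) v) \<le> B * \<epsilon> ^ (l + 1)) (at_top \<times>\<^sub>F F)"
    unfolding case_prod_beta
    using norm_geometric_term_le[OF assms(1)]
    by (intro eventually_mono[OF eventually_prodI[OF eventually_True bound]]) blast
  then show ?thesis
    unfolding word_quantile_def
    by (intro tannerys_theorem[OF tendsto_mult_left[OF tendsto] _ summable_geometric_bound[OF assms(1,2)] F,
          THEN conjunct2, THEN conjunct2])
qed

section \<open>Piecewise continuous functions\<close>

text \<open>Near each point the two one-sided limits and the value at the point bound
  \<open>f\<close>; compactness leaves finitely many such neighbourhoods.\<close>

lemma piecewise_continuous_on_bounded: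
  assumes "piecewise_continuous_on a b f"
  obtains C where "\<And>t. t \<in> {a..b} \<Longrightarrow> \<bar>f t\<bar> \<le> C"
proof -
  have bounded_near: "\<exists>K. eventually (\<lambda>x. \<bar>f x\<bar> \<le> K) F" if "(f \<longlongrightarrow> l) F" for l F
    using order_tendstoD(2)[OF tendsto_rabs[OF that], of "\<bar>l\<bar> + 1"]
    by (auto intro!: exI[of _ "\<bar>l\<bar> + 1"] elim: eventually_mono)
  have "\<exists>T K. open T \<and> t \<in> T \<and> (\<forall>x\<in>T \<inter> {a..b}. \<bar>f x\<bar> \<le> K)" if t: "t \<in> {a..b}" for t
  proof -
    \<comment> \<open>The restriction to \<open>{a..b}\<close> makes the claim vacuous on the left
      of \<open>a\<close>, where no limit is given; likewise below on the right of
      \<open>b\<close>.\<close>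
    have "\<exists>K. eventually (\<lambda>x. x \<in> {a..b} \<longrightarrow> \<bar>f x\<bar> \<le> K) (at_left t)"
    proof (cases "t = a")
      case True
      then show ?thesis by (auto simp: eventually_at_filter)
    next
      case False
      with t assms obtain l where "(f \<longlongrightarrow> l) (at_left t)"
        unfolding piecewise_continuous_on_def by force
      from bounded_near[OF this] show ?thesis by (auto elim: eventually_mono)
    qed
    then obtain K1 where K1: "eventually (\<lambda>x. x \<in> {a..b} \<longrightarrow> \<bar>f x\<bar> \<le> K1) (at_left t)" by blast
    have "\<exists>K. eventually (\<lambda>x. x \<in> {a..b} \<longrightarrow> \<bar>f x\<bar> \<le> K) (at_right t)"
    proof (cases "t = b")
      case True
      then show ?thesis by (auto simp: eventually_at_filter)
    next
      case False
      with t assms obtain l where "(f \<longlongrightarrow> l) (at_right t)"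
        unfolding piecewise_continuous_on_def by force
      from bounded_near[OF this] show ?thesis by (auto elim: eventually_mono)
    qed
    then obtain K2 where K2: "eventually (\<lambda>x. x \<in> {a..b} \<longrightarrow> \<bar>f x\<bar> \<le> K2) (at_right t)" by blast
    let ?K = "max \<bar>f t\<bar> (max K1 K2)"
    have "eventually (\<lambda>x. x \<in> {a..b} \<longrightarrow> \<bar>f x\<bar> \<le> ?K) (at t)"
      using K1 K2 unfolding eventually_at_split by (auto elim!: eventually_mono)
    then have "eventually (\<lambda>x. x \<in> {a..b} \<longrightarrow> \<bar>f x\<bar> \<le> ?K) (nhds t)"
      unfolding eventually_at_filter by (auto elim!: eventually_mono)
    then show ?thesis
      unfolding eventually_nhds by blast
  qed
  then obtain T K where TK: "\<And>t. t \<in> {a..b} \<Longrightarrow> open (T t) \<and> t \<in> T t"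
      "\<And>t x. t \<in> {a..b} \<Longrightarrow> x \<in> T t \<inter> {a..b} \<Longrightarrow> \<bar>f x\<bar> \<le> K t"
    by metis
  obtain D where D: "D \<subseteq> {a..b}" "finite D" "{a..b} \<subseteq> (\<Union>t\<in>D. T t)"
    using TK(1) by (elim compactE_image[OF compact_Icc, of "{a..b}" T a b, rotated 2]) auto
  show thesis
  proof (rule that)
    fix x assume x: "x \<in> {a..b}"
    with D obtain t where t: "t \<in> D" "x \<in> T t" by blast
    then have "\<bar>f x\<bar> \<le> K t" using TK(2) D x by blast
    also have "\<dots> \<le> Max (K ` D)" using t D by auto
    finally show "\<bar>f x\<bar> \<le> Max (K ` D)" .
  qed
qed

text \<open>Off the finite exceptional set \<open>f\<close> is continuous, and changing a function
  at finitely many points preserves measurability. The indicator discards the values outside the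
  interval, about which nothing is known.\<close>

lemma piecewise_continuous_on_borel_measurable:
  assumes "piecewise_continuous_on a b f"
  shows "(\<lambda>t. indicator {a..b} t * f t) \<in> borel_measurable borel"
proof -
  obtain S where S: "finite S" "continuous_on ({a..b} - S) f"
    using assms by (auto simp: piecewise_continuous_on_def)
  have "(\<lambda>t. indicator ({a..b} - S) t *\<^sub>R f t) \<in> borel_measurable borel"
    using S by (intro borel_measurable_continuous_on_indicator) (auto intro: borel_closed finite_imp_closed)
  then show ?thesis
    by (rule measurable_discrete_difference[of _ _ _ S])
       (use S in \<open>auto simp: indicator_def countable_finite\<close>)
qed

section \<open>The functional on the series\<close>

text \<open>Sum and integral may be exchanged because the L1 norms of the terms are dominated by a
  geometric series. Each term contributes \<open>K * \<epsilon> ^ (l + 1)\<close>.\<close>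

lemma set_integral_word_quantile:
  assumes \<epsilon>: "0 \<le> \<epsilon>" "\<epsilon> < 1"
    and f: "piecewise_continuous_on 0 1 f"
    and meas [measurable]: "\<And>l. x (s l) \<in> borel_measurable borel"
    and bound: "\<And>l u. u \<in> {0<..<1} \<Longrightarrow> \<bar>x (s l) u\<bar> \<le> B"
    and int: "\<And>l. (LINT u:{0<..<1}|lborel. f u * x (s l) u) = K"
  shows "(LINT u:{0<..<1}|lborel. f u * word_quantile x \<epsilon> s u) = K * (\<epsilon> / (1 - \<epsilon>))"
proof -
  obtain C where C: "\<And>t. t \<in> {0..1} \<Longrightarrow> \<bar>f t\<bar> \<le> C"
    using piecewise_continuous_on_bounded[OF f] by blast
  define g where "g l u = indicator {0<..<1} u *\<^sub>R (f u * x (s l) u)" for l u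
  let ?h = "\<lambda>l u. \<epsilon> ^ (l + 1) * g l u"
  have C0: "C \<ge> 0" using C[of 0] by auto
  have B0: "B \<ge> 0" using bound[of "1/2" 0] by auto
  have g_bound: "\<bar>g l u\<bar> \<le> C * B * indicator {0<..<1} u" for l u
    using C[of u] bound[of u l] C0 B0 by (auto simp: g_def indicator_def abs_mult intro!: mult_mono)
  have g_bound': "\<bar>g l u\<bar> \<le> C * B" for l u
    using g_bound[of l u] C0 B0 by (cases "u \<in> {0<..<1}") auto
  have [measurable]: "g l \<in> borel_measurable borel" for l
  proof -
    note piecewise_continuous_on_borel_measurable[OF f, measurable]
    \<comment> \<open>The redundant indicator of the closed interval is inserted because
      \<open>f\<close> is known to be measurable only after multiplication by it.\<close>
    have "(\<lambda>u. indicator {0<..<1} u * (indicator {0..1} u * f u * x (s l) u)) \<in> borel_measurable borel"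
      by measurable
    also have "(\<lambda>u. indicator {0<..<1} u * (indicator {0..1} u * f u * x (s l) u)) = g l"
      by (auto simp: g_def indicator_def)
    finally show ?thesis .
  qed
  have g_integrable: "integrable lborel (g l)" for l
    by (rule Bochner_Integration.integrable_bound[of _ "\<lambda>u. C * B * indicator {0<..<1} u"])
       (use g_bound C0 B0 in \<open>auto intro!: integrable_mult_right integrable_real_indicator\<close>)
  have int_g: "integral\<^sup>L lborel (g l) = K" for l
    using int[of l] by (simp add: g_def[abs_def] set_lebesgue_integral_def)
  \<comment> \<open>The interval has length 1, so the pointwise bound also bounds the L1
    norm.\<close>
  have "\<bar>integral\<^sup>L lborel (\<lambda>u. \<bar>g l u\<bar>)\<bar> \<le> C * B" for l
  proof -
    have "integral\<^sup>L lborel (\<lambda>u. \<bar>g l u\<bar>) \<le> integral\<^sup>L lborel (\<lambda>u. C * B * indicator {0<..<1::real} u)"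
      using g_integrable g_bound by (intro integral_mono) (auto intro!: integrable_mult_right integrable_real_indicator)
    then show ?thesis by (simp add: integral_nonneg_AE)
  qed
  then have "summable (\<lambda>l. norm (\<epsilon> ^ (l + 1) * integral\<^sup>L lborel (\<lambda>u. \<bar>g l u\<bar>)))"
    by (intro summable_norm_geometric_series[OF \<epsilon>])
  then have summable_int: "summable (\<lambda>l. integral\<^sup>L lborel (\<lambda>u. norm (?h l u)))"
    using \<epsilon> by (simp add: abs_mult integral_nonneg_AE)
  have "(LINT u:{0<..<1}|lborel. f u * word_quantile x \<epsilon> s u) = (LINT u|lborel. (\<Sum>l. ?h l u))"
    unfolding set_lebesgue_integral_def
  proof (intro Bochner_Integration.integral_cong refl)
    fix u :: real
    show "indicator {0<..<1} u *\<^sub>R (f u * word_quantile x \<epsilon> s u) = (\<Sum>l. ?h l u)"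
    proof (cases "u \<in> {0<..<1}")
      case True
      then have "summable (\<lambda>l. \<epsilon> ^ (l + 1) * x (s l) u)"
        using bound by (intro summable_norm_cancel[OF summable_norm_geometric_series] \<epsilon>)
      from suminf_mult[OF this, of "f u"] True show ?thesis
        by (simp add: g_def word_quantile_def mult_ac)
    qed (simp add: g_def)
  qed
  also have "\<dots> = (\<Sum>l. LINT u|lborel. ?h l u)"
    using g_integrable summable_int summable_norm_geometric_series[OF \<epsilon> g_bound']
    by (intro integral_suminf) auto
  \<comment> \<open>The weights start at the first power of \<open>\<epsilon>\<close>; this extra
    factor is the numerator of the result.\<close>
  also have "\<dots> = (\<Sum>l. (K * \<epsilon>) * \<epsilon> ^ l)"
    by (simp add: int_g mult_ac)
  also have "\<dots> = K * (\<epsilon> / (1 - \<epsilon>))"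
    using \<epsilon> by (subst suminf_mult) (auto simp: suminf_geometric summable_geometric)
  finally show ?thesis .
qed

section \<open>Basic tuples\<close>

lemma basic_tuple_diff_le:
  assumes "basic_tuple M m X r R" "i \<in> {1..m}" "j \<in> {1..m}" "i \<noteq> j"
    "u \<in> {0<..<1}" "v \<in> {0<..<1}"
  shows "\<bar>quantile M (X i) u - quantile M (X j) v\<bar> \<le> R"
proof -
  let ?A = "\<lambda>u v. {ereal \<bar>quantile M (X i1) u - quantile M (X i2) v\<bar> | i1 i2.
             i1 \<in> {1..m} \<and> i2 \<in> {1..m} \<and> i1 \<noteq> i2}"
  have "?A u v \<subseteq> (\<lambda>(i1, i2). ereal \<bar>quantile M (X i1) u - quantile M (X i2) v\<bar>) ` ({1..m} \<times> {1..m})"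
    by auto
  then have "finite (?A u v)" by (rule finite_subset) auto
  then have "ereal \<bar>quantile M (X i) u - quantile M (X j) v\<bar> \<le> Max (?A u v)"
    using assms(2-4) by (intro Max_ge) auto
  also have "\<dots> \<le> (SUP u\<in>{0<..<1}. SUP v\<in>{0<..<1}. Max (?A u v))"
    using assms(5,6) by (intro SUP_upper2[of u] SUP_upper2[of v]) auto
  also have "\<dots> = ereal R"
    using assms(1) by (simp add: basic_tuple_def)
  finally show ?thesis by simp
qed

text \<open>\<open>R\<close> controls only differences between distinct variables, so each quantile
  function is compared with the median of another one. Of the indices 1 and 2, at least one differs
  from \<open>i\<close>, and the sum of both absolute medians covers either choice.\<close>

lemma basic_tuple_bounded:
  assumes X: "basic_tuple M m X r R"
  obtains B where "\<And>i u. i \<in> {1..m} \<Longrightarrow> u \<in> {0<..<1} \<Longrightarrow> \<bar>quantile M (X i) u\<bar> \<le> B"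
proof
  have m: "m \<ge> 3" using X by (simp add: basic_tuple_def)
  let ?q = "\<lambda>i. \<bar>quantile M (X i) (1/2)\<bar>"
  fix i u assume iu: "i \<in> {1..m}" "u \<in> {0<..<1::real}"
  obtain j where j: "j \<in> {1, 2}" "j \<noteq> i" by (metis insertCI one_eq_numeral_iff semiring_norm(85))
  have "\<bar>quantile M (X i) u - quantile M (X j) (1/2)\<bar> \<le> R"
    using iu j m by (intro basic_tuple_diff_le[OF X]) auto
  then show "\<bar>quantile M (X i) u\<bar> \<le> ?q 1 + ?q 2 + R" using j by auto
qed

theorem proposition2:
  fixes M :: "'a measure" and N :: "'b measure"
    and X0 :: "nat \<Rightarrow> 'a \<Rightarrow> real" and U :: "(nat \<Rightarrow> nat) \<Rightarrow> 'b \<Rightarrow> real"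
    and m :: nat and r R lam \<epsilon> K :: real and f :: "real \<Rightarrow> real"
  assumes "m \<ge> 3"
    and "basic_tuple M m X0 r R"
    and "lam > 1 + R / r" and "\<epsilon> = 1 / lam"
    and "indep_uniform_family N (index_words m) U"
    and "piecewise_continuous_on 0 1 f"
    and "\<forall>i\<in>{1..m}. J M f (X0 i) = K"
  shows "\<forall>X\<in>infinite_generation (\<lambda>i. quantile M (X0 i)) m \<epsilon> U. J N f X = K * (\<epsilon> / (1 - \<epsilon>))"
proof
  fix X assume "X \<in> infinite_generation (\<lambda>i. quantile M (X0 i)) m \<epsilon> U"
  then obtain s where s: "s \<in> index_words m"
    and X: "X = (\<lambda>\<omega>. word_quantile (\<lambda>i. quantile M (X0 i)) \<epsilon> s (U s \<omega>))"
    by (auto simp: infinite_generation_def)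
  let ?x = "\<lambda>i. quantile M (X0 i)" and ?w = "word_quantile (\<lambda>i. quantile M (X0 i)) \<epsilon> s"
  have letters: "s l \<in> {1..m}" for l
    using s by (auto simp: index_words_def)
  interpret M: prob_space M
    using assms(2) by (simp add: basic_tuple_def)
  interpret N: prob_space N
    using assms(5) by (simp add: indep_uniform_family_def)
  have X0: "X0 (s l) \<in> borel_measurable M" for l
    using assms(2) letters[of l] by (auto simp: basic_tuple_def M.indep_vars_def)
  have Us: "U s \<in> borel_measurable N" "distr N borel (U s) = uniform_measure lborel {0..1}"
    using assms(5) s by (auto simp: indep_uniform_family_def N.indep_vars_def)
  \<comment> \<open>\<open>R\<close> dominates an absolute value. With \<open>r > 0\<close> this
    turns the hypothesis on \<open>lam\<close> into \<open>lam > 1\<close>, hence convergence of the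
    geometric series.\<close>
  have "R \<ge> 0"
    using basic_tuple_diff_le[OF assms(2), of 1 2 "1/2" "1/2"] assms(1) by auto
  moreover have "r > 0"
    using assms(2) by (simp add: basic_tuple_def)
  ultimately have "lam > 1"
    using assms(3) by (smt (verit) divide_nonneg_pos)
  then have \<epsilon>: "0 \<le> \<epsilon>" "\<epsilon> < 1"
    using assms(4) by auto
  obtain B where B: "\<And>l u. u \<in> {0<..<1} \<Longrightarrow> \<bar>?x (s l) u\<bar> \<le> B"
    using basic_tuple_bounded[OF assms(2)] letters by metis
  note [measurable] = M.borel_measurable_quantile[OF X0]
  have w_meas: "?w \<in> borel_measurable borel"
    unfolding word_quantile_def by measurable
  have w_mono: "mono_on {0<..<1} ?w"
    by (intro mono_on_word_quantile[where x = ?x, OF \<epsilon> B] M.mono_on_quantile X0)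
  \<comment> \<open>Agreement on the open unit interval suffices, as \<open>J\<close> integrates
    only there.\<close>
  have "quantile N X u = ?w u" if u: "u \<in> {0<..<1}" for u
  proof -
    have "eventually (\<lambda>v. \<forall>l. \<bar>?x (s l) v\<bar> \<le> B) (at_left u)"
      using eventually_at_left_real[of 0 u] u B
      by (auto elim!: eventually_mono)
    then have "(?w \<longlongrightarrow> ?w u) (at_left u)"
      using u by (intro word_quantile_tendsto[OF \<epsilon>] M.quantile_tendsto_at_left X0) auto
    then show ?thesis
      unfolding X using u by (intro N.quantile_comp_uniform[OF Us w_meas w_mono]) auto
  qed
  then have "J N f X = (LINT u:{0<..<1}|lborel. f u * ?w u)"
    unfolding J_def by (intro set_lebesgue_integral_cong) auto
  also have "\<dots> = K * (\<epsilon> / (1 - \<epsilon>))"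
    using assms(7) letters
    by (intro set_integral_word_quantile[where x = ?x, OF \<epsilon> assms(6) M.borel_measurable_quantile[OF X0] B])
       (auto simp: J_def)
  finally show "J N f X = K * (\<epsilon> / (1 - \<epsilon>))" .
qed

end
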